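(* Let $m,n\ge 1$ be integers and let $A=[A_{i,j}]_{i,j=1}^m\in \mathbb{M}_m(\mathbb{M}_n)$ be positive semidefinite. Then \[ I_m\otimes \mathrm{tr}_1 A^{\tau}\ \ge\ -A^{\tau}+2D_A, \] where $D_A=A_{1,1}\oplus A_{2,2}\oplus\cdots\oplus A_{m,m}$.
   Context: $\mathbb{M}_n$ is the space of $n\times n$ complex matrices. $\mathbb{M}_m(\mathbb{M}_n)$ is the set of $m\times m$ block matrices $A=[A_{i,j}]_{i,j=1}^m$ with blocks $A_{i,j}\in\mathbb{M}_n$, regarded also as $mn\times mn$ complex matrices. For Hermitian $X,Y$ of the same size, $X\ge Y$ means $X-Y$ is positive semidefinite. The partial transpose of $A$ is $A^{\tau}=[A_{j,i}]_{i,j=1}^m$ (the $(i,j)$ block of $A^\tau$ is $A_{j,i}$; the blocks themselves are not transposed). The first partial trace is $\mathrm{tr}_1 A=\sum_{i=1}^m A_{i,i}\in\mathbb{M}_n$; $\mathrm{tr}_1 A^\tau$ means $\mathrm{tr}_1(A^\tau)$. $\otimes$ is the Kronecker product: for $X=[x_{i,j}]\in\mathbb{M}_m$ and $Y\in\mathbb{M}_n$, $X\otimes Y\in\mathbb{M}_m(\mathbb{M}_n)$ has $(i,j)$ block $x_{i,j}Y$. $\oplus$ is the block-diagonal direct sum. *)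

theory Defs
  imports "Jordan_Normal_Form.Schur_Decomposition"
begin

text \<open>
  A block matrix in M_m(M_n) is represented by the (m n) x (m n) matrix it is regarded as.
  Indices start at 0, so that row \<open>i * n + k\<close> is row \<open>k\<close> of block row \<open>i\<close>.
\<close>

definition mblock :: "nat \<Rightarrow> complex mat \<Rightarrow> nat \<Rightarrow> nat \<Rightarrow> complex mat" where
  "mblock n A i j = mat n n (\<lambda>(k, l). A $$ (i * n + k, j * n + l))"

definition of_blocks :: "nat \<Rightarrow> nat \<Rightarrow> (nat \<Rightarrow> nat \<Rightarrow> complex mat) \<Rightarrow> complex mat" where
  "of_blocks m n B = mat (m * n) (m * n) (\<lambda>(r, c). B (r div n) (c div n) $$ (r mod n, c mod n))"

definition partial_transpose :: "nat \<Rightarrow> nat \<Rightarrow> complex mat \<Rightarrow> complex mat" where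
  "partial_transpose m n A = of_blocks m n (\<lambda>i j. mblock n A j i)"

text \<open>The sum of the diagonal blocks, written entrywise since \<^typ>\<open>complex mat\<close>
  (matrices of all dimensions) is not an additive monoid.\<close>

definition partial_trace1 :: "nat \<Rightarrow> nat \<Rightarrow> complex mat \<Rightarrow> complex mat" where
  "partial_trace1 m n A = mat n n (\<lambda>(k, l). \<Sum>i<m. mblock n A i i $$ (k, l))"

definition diag_blocks :: "nat \<Rightarrow> nat \<Rightarrow> complex mat \<Rightarrow> complex mat" where
  "diag_blocks m n A = diag_block_mat (map (\<lambda>i. mblock n A i i) [0..<m])"

definition kronecker :: "complex mat \<Rightarrow> complex mat \<Rightarrow> complex mat" where
  "kronecker X Y = mat (dim_row X * dim_row Y) (dim_col X * dim_col Y)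
     (\<lambda>(r, c). X $$ (r div dim_row Y, c div dim_col Y) * Y $$ (r mod dim_row Y, c mod dim_col Y))"

definition hermitian_mat :: "nat \<Rightarrow> complex mat \<Rightarrow> bool" where
  "hermitian_mat d M \<longleftrightarrow> M \<in> carrier_mat d d \<and> mat_adjoint M = M"

text \<open>\<open>(M *\<^sub>v v) \<bullet>c v\<close> is the quadratic form v* M v; the order on \<^typ>\<open>complex\<close> used here
  makes \<open>0 \<le> z\<close> mean that z is real and nonnegative.\<close>

definition psd_mat :: "nat \<Rightarrow> complex mat \<Rightarrow> bool" where
  "psd_mat d M \<longleftrightarrow> hermitian_mat d M \<and> (\<forall>v \<in> carrier_vec d. 0 \<le> (M *\<^sub>v v) \<bullet>c v)"

text \<open>The Loewner order. It is unrelated to the entrywise order \<open>\<le>\<close> that the library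
  puts on matrices.\<close>

definition loewner_ge :: "nat \<Rightarrow> complex mat \<Rightarrow> complex mat \<Rightarrow> bool" where
  "loewner_ge d X Y \<longleftrightarrow> hermitian_mat d X \<and> hermitian_mat d Y \<and> psd_mat d (X - Y)"

lemma block_index_less:
  fixes i k m n :: nat
  assumes "i < m" "k < n"
  shows "i * n + k < m * n"
proof -
  have "i * n + k < Suc i * n" using assms by simp
  also have "\<dots> \<le> m * n" using assms by (intro mult_le_mono1) simp
  finally show ?thesis .
qed

lemma mblock_of_blocks:
  assumes "i < m" "j < m" "B i j \<in> carrier_mat n n"
  shows "mblock n (of_blocks m n B) i j = B i j"
  using assms by (intro eq_matI) (auto simp: mblock_def of_blocks_def block_index_less)

lemma of_blocks_mblock:
  assumes "A \<in> carrier_mat (m * n) (m * n)"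
  shows "of_blocks m n (mblock n A) = A"
proof (cases "n = 0")
  case False
  with assms show ?thesis
    by (intro eq_matI) (auto simp: mblock_def of_blocks_def)
qed (use assms in \<open>auto simp: of_blocks_def\<close>)

lemma mblock_partial_transpose:
  "i < m \<Longrightarrow> j < m \<Longrightarrow> mblock n (partial_transpose m n A) i j = mblock n A j i"
  unfolding partial_transpose_def by (rule mblock_of_blocks) (auto simp: mblock_def)

lemma mblock_kronecker:
  assumes "X \<in> carrier_mat m m" "Y \<in> carrier_mat n n" "i < m" "j < m"
  shows "mblock n (kronecker X Y) i j = X $$ (i, j) \<cdot>\<^sub>m Y"
  using assms by (intro eq_matI) (auto simp: mblock_def kronecker_def block_index_less)

end

theory Submission
  imports Defs
begin

text \<open>
  Split a vector \<open>v\<close> into \<open>m\<close> segments \<open>v\<^sub>0, \<dots>, v\<^sub>m\<^sub>-\<^sub>1\<close> of length \<open>n\<close>, and write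
  \<open>f\<^sub>a\<^sub>b(x, y) = x* A\<^sub>a\<^sub>b y\<close>. The quadratic form of the difference
  \<open>I \<otimes> tr\<^sub>1 A\<^sup>\<tau> + A\<^sup>\<tau> - 2 D\<^sub>A\<close> at \<open>v\<close> is
  \<open>\<Sum>\<^sub>a \<Sum>\<^sub>b (f\<^sub>b\<^sub>b(v\<^sub>a, v\<^sub>a) + f\<^sub>b\<^sub>a(v\<^sub>a, v\<^sub>b)) - 2 \<Sum>\<^sub>a f\<^sub>a\<^sub>a(v\<^sub>a, v\<^sub>a)\<close>, and the terms with \<open>a = b\<close>
  of the double sum cancel exactly against the last sum. What remains is a sum over \<open>a \<noteq> b\<close>.
  The contributions of \<open>(a, b)\<close> and \<open>(b, a)\<close> add up to
  \<open>f\<^sub>a\<^sub>a(v\<^sub>b, v\<^sub>b) + f\<^sub>a\<^sub>b(v\<^sub>b, v\<^sub>a) + f\<^sub>b\<^sub>a(v\<^sub>a, v\<^sub>b) + f\<^sub>b\<^sub>b(v\<^sub>a, v\<^sub>a)\<close>,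
  which is the quadratic form of \<open>A\<close> itself at the vector that carries \<open>v\<^sub>b\<close> in segment \<open>a\<close>,
  \<open>v\<^sub>a\<close> in segment \<open>b\<close> and zero elsewhere (lemma \<open>psd_swapped_segments\<close>). The exchange of the
  two segments undoes the transposition of the blocks, so each such sum is nonnegative because
  \<open>A\<close> is positive semidefinite, although \<open>A\<^sup>\<tau>\<close> in general is not.
\<close>

section \<open>Sums and Hermitian matrices in block coordinates\<close>

lemma sum_block_index:
  fixes f :: "nat \<Rightarrow> 'a :: comm_monoid_add"
  shows "(\<Sum>r<m * n. f r) = (\<Sum>a<m. \<Sum>k<n. f (a * n + k))"
proof -
  have "(\<Sum>r<m * n. f r) = (\<Sum>a<m. sum f {a * n..<a * n + n})"
    by (simp add: sum.nat_group)
  moreover have "sum f {s..<s + n} = (\<Sum>k<n. f (s + k))" for s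
    by (induction n) simp_all
  ultimately show ?thesis by simp
qed

lemma block_indexE:
  fixes r m n :: nat
  assumes "r < m * n"
  obtains a k where "a < m" "k < n" "r = a * n + k"
proof
  from assms have "0 < n" by (cases n) auto
  then show "r mod n < n" by simp
  show "r div n < m" using assms by (simp add: less_mult_imp_div_less)
  show "r = r div n * n + r mod n" by simp
qed

lemma hermitian_mat_iff:
  "hermitian_mat d M \<longleftrightarrow>
     M \<in> carrier_mat d d \<and> (\<forall>i<d. \<forall>j<d. M $$ (j, i) = cnj (M $$ (i, j)))"
proof -
  have "mat_adjoint M = M \<longleftrightarrow> (\<forall>i<d. \<forall>j<d. M $$ (j, i) = cnj (M $$ (i, j)))"
    if M: "M \<in> carrier_mat d d"
  proof -
    have idx: "mat_adjoint M $$ (j, i) = cnj (M $$ (i, j))" if "i < d" "j < d" for i j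
      using M that by (simp add: mat_adjoint_def mat_of_rows_def)
    have dims: "dim_row (mat_adjoint M) = d" "dim_col (mat_adjoint M) = d"
      using M by (simp_all add: mat_adjoint_def)
    show ?thesis
    proof
      assume "mat_adjoint M = M"
      with idx show "\<forall>i<d. \<forall>j<d. M $$ (j, i) = cnj (M $$ (i, j))" by metis
    next
      assume "\<forall>i<d. \<forall>j<d. M $$ (j, i) = cnj (M $$ (i, j))"
      with idx have "mat_adjoint M $$ (i, j) = M $$ (i, j)" if "i < d" "j < d" for i j
        using that by metis
      with dims M show "mat_adjoint M = M" by (intro eq_matI) auto
    qed
  qed
  then show ?thesis unfolding hermitian_mat_def by blast
qed

lemma hermitian_mat_blockI:
  assumes "M \<in> carrier_mat (m * n) (m * n)"
    and "\<And>a b k l. \<lbrakk>a < m; b < m; k < n; l < n\<rbrakk> \<Longrightarrow>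
           mblock n M b a $$ (l, k) = cnj (mblock n M a b $$ (k, l))"
  shows "hermitian_mat (m * n) M"
  unfolding hermitian_mat_iff
proof (intro conjI allI impI assms(1))
  fix r c assume "r < m * n" "c < m * n"
  then obtain a k b l where "a < m" "k < n" "r = a * n + k" "b < m" "l < n" "c = b * n + l"
    by (elim block_indexE) blast
  with assms(2)[of a b k l] show "M $$ (c, r) = cnj (M $$ (r, c))"
    by (simp add: mblock_def)
qed

lemma hermitian_mat_blockD:
  assumes "hermitian_mat (m * n) M" "a < m" "b < m" "k < n" "l < n"
  shows "mblock n M b a $$ (l, k) = cnj (mblock n M a b $$ (k, l))"
proof -
  have "M $$ (b * n + l, a * n + k) = cnj (M $$ (a * n + k, b * n + l))"
    using assms unfolding hermitian_mat_iff by (blast intro: block_index_less)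
  then show ?thesis using assms(4,5) by (simp add: mblock_def)
qed

section \<open>The quadratic form of a block matrix\<close>

definition block_form :: "nat \<Rightarrow> complex mat \<Rightarrow> (nat \<Rightarrow> complex) \<Rightarrow> (nat \<Rightarrow> complex) \<Rightarrow> complex" where
  "block_form n B x y = (\<Sum>k<n. \<Sum>l<n. B $$ (k, l) * y l * cnj (x k))"

definition segment :: "nat \<Rightarrow> complex vec \<Rightarrow> nat \<Rightarrow> nat \<Rightarrow> complex" where
  "segment n v a k = v $ (a * n + k)"

lemma block_form_zero [simp]:
  "block_form n B (\<lambda>_. 0) y = 0" "block_form n B x (\<lambda>_. 0) = 0"
  by (simp_all add: block_form_def)

lemma quadratic_form_blocks:
  assumes "M \<in> carrier_mat (m * n) (m * n)" "v \<in> carrier_vec (m * n)"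
  shows "(M *\<^sub>v v) \<bullet>c v =
    (\<Sum>a<m. \<Sum>b<m. block_form n (mblock n M a b) (segment n v a) (segment n v b))"
proof -
  have "(M *\<^sub>v v) \<bullet>c v = (\<Sum>r<m * n. \<Sum>c<m * n. M $$ (r, c) * v $ c * cnj (v $ r))"
    using assms by (simp add: scalar_prod_def sum_distrib_right atLeast0LessThan)
  also have "\<dots> = (\<Sum>a<m. \<Sum>k<n. \<Sum>b<m. \<Sum>l<n.
      M $$ (a * n + k, b * n + l) * v $ (b * n + l) * cnj (v $ (a * n + k)))"
    by (simp add: sum_block_index)
  also have "\<dots> = (\<Sum>a<m. \<Sum>b<m. \<Sum>k<n. \<Sum>l<n.
      M $$ (a * n + k, b * n + l) * v $ (b * n + l) * cnj (v $ (a * n + k)))"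
    by (intro sum.cong refl sum.swap)
  finally show ?thesis
    by (simp add: block_form_def segment_def mblock_def)
qed

text \<open>
  A vector supported on two segments only sees the corresponding two-by-two block submatrix of
  \<open>A\<close>. Putting \<open>v\<^sub>b\<close> in segment \<open>a\<close> and \<open>v\<^sub>a\<close> in segment \<open>b\<close> makes the off-diagonal block
  \<open>A\<^sub>b\<^sub>a\<close> act from \<open>v\<^sub>b\<close> to \<open>v\<^sub>a\<close>, which is where the partial transpose places it.
\<close>

lemma psd_swapped_segments:
  assumes "psd_mat (m * n) A" "a < m" "b < m" "a \<noteq> b"
  shows "0 \<le> block_form n (mblock n A a a) (segment n v b) (segment n v b)
           + block_form n (mblock n A a b) (segment n v b) (segment n v a)
           + block_form n (mblock n A b a) (segment n v a) (segment n v b)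
           + block_form n (mblock n A b b) (segment n v a) (segment n v a)"
proof -
  define u where "u = (\<lambda>c. if c = a then segment n v b else if c = b then segment n v a else (\<lambda>_. 0))"
  define w where "w = vec (m * n) (\<lambda>r. u (r div n) (r mod n))"
  have w: "w \<in> carrier_vec (m * n)" by (simp add: w_def)
  have A: "A \<in> carrier_mat (m * n) (m * n)"
    using assms(1) by (simp add: psd_mat_def hermitian_mat_def)
  have seg: "segment n w c k = u c k" if "c < m" "k < n" for c k
    using that by (simp add: segment_def w_def block_index_less)
  have "(A *\<^sub>v w) \<bullet>c w = (\<Sum>c<m. \<Sum>d<m. block_form n (mblock n A c d) (u c) (u d))"
    unfolding quadratic_form_blocks[OF A w] block_form_def
    by (intro sum.cong refl) (simp add: seg)
  also have "\<dots> = (\<Sum>c<m. \<Sum>d\<in>{a, b}. block_form n (mblock n A c d) (u c) (u d))"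
    using assms by (intro sum.cong refl sum.mono_neutral_right) (auto simp: u_def)
  also have "\<dots> = (\<Sum>c\<in>{a, b}. \<Sum>d\<in>{a, b}. block_form n (mblock n A c d) (u c) (u d))"
    using assms by (intro sum.mono_neutral_right) (auto simp: u_def)
  also have "\<dots> = block_form n (mblock n A a a) (segment n v b) (segment n v b)
           + block_form n (mblock n A a b) (segment n v b) (segment n v a)
           + block_form n (mblock n A b a) (segment n v a) (segment n v b)
           + block_form n (mblock n A b b) (segment n v a) (segment n v a)"
    using assms(4) by (simp add: u_def add.assoc)
  finally show ?thesis
    using assms(1) w unfolding psd_mat_def by metis
qed

section \<open>The blocks of the difference\<close>

lemma diag_block_mat_dims:
  assumes "\<And>i. B i \<in> carrier_mat n n"
  shows "diag_block_mat (map B [0..<m]) \<in> carrier_mat (m * n) (m * n)"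
proof -
  have "dim_row (B i) = n" "dim_col (B i) = n" for i using assms[of i] by auto
  then show ?thesis
    by (intro carrier_matI) (simp_all add: dim_diag_block_mat o_def sum_list_triv)
qed

lemma mblock_diag_block_mat:
  assumes B: "\<And>i. B i \<in> carrier_mat n n" and "a < m" "b < m" "k < n" "l < n"
  shows "mblock n (diag_block_mat (map B [0..<m])) a b $$ (k, l) = (if a = b then B a $$ (k, l) else 0)"
  using assms(2,3)
proof (induction m)
  case (Suc m)
  let ?D = "diag_block_mat (map B [0..<m])"
  have D: "dim_row ?D = m * n" "dim_col ?D = m * n"
    using diag_block_mat_dims[of B n m] B by auto
  have dB: "dim_row (B m) = n" "dim_col (B m) = n" using B[of m] by auto
  \<comment> \<open>Appending a block splits the indices at \<open>m * n\<close>, which separates block \<open>m\<close> from the others.\<close>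
  have idx: "c * n + j < m * n \<longleftrightarrow> c \<noteq> m" if "c < Suc m" "j < n" for c j
    using that block_index_less[of c m j n] by (cases "c = m") auto
  have idx': "c * n + j < m * n + n" if "c < Suc m" "j < n" for c j
    using that block_index_less[of c "Suc m" j n] by (simp add: add.commute)
  have "?D $$ (a * n + k, b * n + l) = (if a = b then B a $$ (k, l) else 0)" if "a \<noteq> m" "b \<noteq> m"
    using Suc that assms(4,5) by (simp add: mblock_def)
  then show ?case
    using Suc.prems assms(4,5) D dB
    by (auto simp: mblock_def diag_block_mat_last Let_def idx idx')
qed simp

lemma carrier_of_blocks [simp]: "of_blocks m n B \<in> carrier_mat (m * n) (m * n)"
  by (simp add: of_blocks_def)

lemma carrier_partial_transpose [simp]: "partial_transpose m n A \<in> carrier_mat (m * n) (m * n)"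
  by (simp add: partial_transpose_def)

lemma carrier_partial_trace1 [simp]: "partial_trace1 m n A \<in> carrier_mat n n"
  by (simp add: partial_trace1_def)

lemma carrier_diag_blocks [simp]: "diag_blocks m n A \<in> carrier_mat (m * n) (m * n)"
  unfolding diag_blocks_def by (rule diag_block_mat_dims) (simp add: mblock_def)

lemma carrier_kronecker:
  "X \<in> carrier_mat m m \<Longrightarrow> Y \<in> carrier_mat n n \<Longrightarrow> kronecker X Y \<in> carrier_mat (m * n) (m * n)"
  by (auto simp: kronecker_def)

lemma mblock_diag_blocks:
  assumes "a < m" "b < m" "k < n" "l < n"
  shows "mblock n (diag_blocks m n A) a b $$ (k, l) = (if a = b then mblock n A a a $$ (k, l) else 0)"
  unfolding diag_blocks_def using assms by (subst mblock_diag_block_mat) (auto simp: mblock_def)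

text \<open>The partial transpose fixes the diagonal blocks, hence the first partial trace.\<close>

lemma mblock_identity_kronecker_trace:
  assumes "a < m" "b < m" "k < n" "l < n"
  shows "mblock n (kronecker (1\<^sub>m m) (partial_trace1 m n (partial_transpose m n A))) a b $$ (k, l)
    = (if a = b then \<Sum>p<m. mblock n A p p $$ (k, l) else 0)"
  using assms
  by (subst mblock_kronecker[of _ m]) (auto simp: partial_trace1_def mblock_partial_transpose)

lemma mblock_diag_minus_transpose:
  assumes "a < m" "b < m" "k < n" "l < n"
  shows "mblock n (- partial_transpose m n A + 2 \<cdot>\<^sub>m diag_blocks m n A) a b $$ (k, l)
    = - mblock n A b a $$ (k, l) + (if a = b then 2 * mblock n A a a $$ (k, l) else 0)"
proof -
  have "mblock n (- partial_transpose m n A + 2 \<cdot>\<^sub>m diag_blocks m n A) a b $$ (k, l)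
    = - mblock n (partial_transpose m n A) a b $$ (k, l) + 2 * mblock n (diag_blocks m n A) a b $$ (k, l)"
    using assms carrier_partial_transpose[of m n A] carrier_diag_blocks[of m n A]
    by (simp add: mblock_def[of n _ a b] block_index_less carrier_matD del: carrier_partial_transpose carrier_diag_blocks)
  then show ?thesis
    using assms by (simp add: mblock_partial_transpose mblock_diag_blocks)
qed

section \<open>The inequality\<close>

theorem theorem2p1:
  fixes m n :: nat and A :: "complex mat"
  assumes "1 \<le> m" and "1 \<le> n"
    and "A \<in> carrier_mat (m * n) (m * n)"
    and "psd_mat (m * n) A"
  shows "loewner_ge (m * n)
    (kronecker (1\<^sub>m m) (partial_trace1 m n (partial_transpose m n A)))
    (- partial_transpose m n A + 2 \<cdot>\<^sub>m diag_blocks m n A)"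
proof -
  define X where "X = kronecker (1\<^sub>m m) (partial_trace1 m n (partial_transpose m n A))"
  define Y where "Y = - partial_transpose m n A + 2 \<cdot>\<^sub>m diag_blocks m n A"
  have X: "X \<in> carrier_mat (m * n) (m * n)"
    unfolding X_def by (rule carrier_kronecker) simp_all
  have Y: "Y \<in> carrier_mat (m * n) (m * n)"
    unfolding Y_def by (intro add_carrier_mat smult_carrier_mat carrier_diag_blocks)
  have Z: "X - Y \<in> carrier_mat (m * n) (m * n)" using Y by (rule minus_carrier_mat)
  have hermA: "mblock n A b a $$ (l, k) = cnj (mblock n A a b $$ (k, l))"
    if "a < m" "b < m" "k < n" "l < n" for a b k l
    using assms(4) that hermitian_mat_blockD unfolding psd_mat_def by blast
  note blockX = mblock_identity_kronecker_trace[where m = m and n = n and A = A, folded X_def]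
  note blockY = mblock_diag_minus_transpose[where m = m and n = n and A = A, folded Y_def]
  have blockZ: "mblock n (X - Y) a b $$ (k, l) =
      (if a = b then (\<Sum>p<m. mblock n A p p $$ (k, l)) - 2 * mblock n A a a $$ (k, l) else 0)
      + mblock n A b a $$ (k, l)"
    if "a < m" "b < m" "k < n" "l < n" for a b k l
  proof -
    have "mblock n (X - Y) a b $$ (k, l) = mblock n X a b $$ (k, l) - mblock n Y a b $$ (k, l)"
      using that X Y by (simp add: mblock_def block_index_less)
    then show ?thesis using that by (simp add: blockX blockY)
  qed
  have hermX: "hermitian_mat (m * n) X"
  proof (rule hermitian_mat_blockI[OF X])
    fix a b k l assume "a < m" "b < m" "k < n" "l < n"
    moreover from this have "(\<Sum>p<m. mblock n A p p $$ (l, k)) = (\<Sum>p<m. cnj (mblock n A p p $$ (k, l)))"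
      by (intro sum.cong refl hermA) auto
    ultimately show "mblock n X b a $$ (l, k) = cnj (mblock n X a b $$ (k, l))"
      by (simp add: blockX)
  qed
  have hermY: "hermitian_mat (m * n) Y"
  proof (rule hermitian_mat_blockI[OF Y])
    fix a b k l assume "a < m" "b < m" "k < n" "l < n"
    then show "mblock n Y b a $$ (l, k) = cnj (mblock n Y a b $$ (k, l))"
      using hermA[of a a k l] hermA[of b a k l] by (simp add: blockY)
  qed
  have hermZ: "hermitian_mat (m * n) (X - Y)"
    unfolding hermitian_mat_iff
  proof (intro conjI allI impI Z)
    fix r c assume "r < m * n" "c < m * n"
    moreover from this have "X $$ (c, r) = cnj (X $$ (r, c))" "Y $$ (c, r) = cnj (Y $$ (r, c))"
      using hermX hermY unfolding hermitian_mat_iff by blast+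
    ultimately show "(X - Y) $$ (c, r) = cnj ((X - Y) $$ (r, c))"
      using X Y by simp
  qed
  have "0 \<le> ((X - Y) *\<^sub>v v) \<bullet>c v" if v: "v \<in> carrier_vec (m * n)" for v
  proof -
    define f where "f a b p q = block_form n (mblock n A a b) (segment n v p) (segment n v q)" for a b p q
    \<comment> \<open>the summand left for \<open>(a, b)\<close> once the diagonal terms have cancelled\<close>
    define h where "h a b = (if a = b then 0 else f b b a a + f b a a b)" for a b
    have formZ: "block_form n (mblock n (X - Y) a b) (segment n v a) (segment n v b) =
        (if a = b then (\<Sum>p<m. f p p a a) - 2 * f a a a a else 0) + f b a a b"
      if "a < m" "b < m" for a b
    proof -
      have "block_form n (mblock n (X - Y) a b) (segment n v a) (segment n v b) =
          (\<Sum>k<n. \<Sum>l<n.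
            ((if a = b then (\<Sum>p<m. mblock n A p p $$ (k, l)) - 2 * mblock n A a a $$ (k, l) else 0)
             + mblock n A b a $$ (k, l)) * segment n v b l * cnj (segment n v a k))"
        unfolding block_form_def using that by (intro sum.cong refl) (simp add: blockZ)
      also have "\<dots> = (if a = b then (\<Sum>k<n. \<Sum>l<n. \<Sum>p<m. mblock n A p p $$ (k, l) *
            segment n v a l * cnj (segment n v a k)) - 2 * f a a a a else 0) + f b a a b"
        by (simp add: f_def block_form_def algebra_simps sum.distrib sum_subtractf
            sum_distrib_left sum_distrib_right)
      also have "(\<Sum>k<n. \<Sum>l<n. \<Sum>p<m. mblock n A p p $$ (k, l) *
            segment n v a l * cnj (segment n v a k)) = (\<Sum>p<m. f p p a a)"
        unfolding f_def block_form_def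
        by (simp only: sum.swap[where A = "{..<n}" and B = "{..<m}"])
      finally show ?thesis .
    qed
    have "((X - Y) *\<^sub>v v) \<bullet>c v =
        (\<Sum>a<m. \<Sum>b<m. (if a = b then (\<Sum>p<m. f p p a a) - 2 * f a a a a else 0) + f b a a b)"
      unfolding quadratic_form_blocks[OF Z v] by (intro sum.cong refl formZ) auto
    also have "\<dots> = (\<Sum>a<m. (\<Sum>b<m. f b b a a + f b a a b) - 2 * f a a a a)"
      by (intro sum.cong refl) (simp add: sum.distrib)
    also have "\<dots> = (\<Sum>a<m. \<Sum>b<m. h a b)"
    proof (intro sum.cong refl)
      fix a assume a: "a \<in> {..<m}"
      have "(\<Sum>b<m. f b b a a + f b a a b) = (\<Sum>b<m. h a b + (if a = b then 2 * f a a a a else 0))"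
        by (intro sum.cong refl) (simp add: h_def)
      then show "(\<Sum>b<m. f b b a a + f b a a b) - 2 * f a a a a = (\<Sum>b<m. h a b)"
        using a by (simp add: sum.distrib)
    qed
    finally have form: "((X - Y) *\<^sub>v v) \<bullet>c v = (\<Sum>a<m. \<Sum>b<m. h a b)" .
    \<comment> \<open>A single \<open>h a b\<close> has no sign and need not even be real; symmetrising the double sum
      pairs it with \<open>h b a\<close>, at the price of a factor two.\<close>
    have "0 \<le> h a b + h b a" if "a < m" "b < m" for a b
      using psd_swapped_segments[OF assms(4) that, of v]
      by (cases "a = b") (simp_all add: h_def f_def algebra_simps)
    then have "0 \<le> (\<Sum>a<m. \<Sum>b<m. h a b + h b a)"
      by (intro sum_nonneg) auto
    also have "\<dots> = (\<Sum>a<m. \<Sum>b<m. h a b) + (\<Sum>a<m. \<Sum>b<m. h b a)"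
      by (simp add: sum.distrib)
    also have "(\<Sum>a<m. \<Sum>b<m. h b a) = (\<Sum>a<m. \<Sum>b<m. h a b)"
      by (rule sum.swap)
    finally show ?thesis
      unfolding form by (simp add: less_eq_complex_def)
  qed
  with hermX hermY hermZ show ?thesis
    by (simp add: loewner_ge_def psd_mat_def X_def Y_def)
qed

end
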